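(* Let $N\ge1$ and $f\in C^1(\mathbb{R})$. Assume that $u=0$ is the only bounded stable $C^2$ solution of $-\Delta u=f(u)$ in $\mathbb{R}^N$. If $u\in C^2(\mathbb{R}^N)$ is a bounded solution of $-\Delta u=f(u)$ in $\mathbb{R}^N$ which is stable outside a compact set, then $\lim_{|x|\to\infty}u(x)=0$.
   Context: A solution $u\in C^2(\mathbb{R}^N)$ of $-\Delta u=f(u)$ in $\mathbb{R}^N$ is stable if $\int_{\mathbb{R}^N} f'(u)\varphi^2\,dx\le\int_{\mathbb{R}^N}|\nabla\varphi|^2\,dx$ for all $\varphi\in C^1_c(\mathbb{R}^N)$. It is stable outside a compact set if there is a compact set $K\subset\mathbb{R}^N$ such that this inequality holds for all $\varphi\in C^1_c(\mathbb{R}^N\setminus K)$. *)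

theory Defs
  imports "HOL-Analysis.Analysis"
begin

definition pderivative :: "'n::finite \<Rightarrow> (real^'n \<Rightarrow> real) \<Rightarrow> real^'n \<Rightarrow> real" where
  "pderivative i u x = frechet_derivative u (at x) (axis i 1)"

definition grad :: "(real^'n::finite \<Rightarrow> real) \<Rightarrow> real^'n \<Rightarrow> real^'n" where
  "grad u x = (\<chi> i. pderivative i u x)"

definition laplacian :: "(real^'n::finite \<Rightarrow> real) \<Rightarrow> real^'n \<Rightarrow> real" where
  "laplacian u x = (\<Sum>i\<in>UNIV. pderivative i (pderivative i u) x)"

text \<open>The differentiability conjunct is needed because \<^const>\<open>frechet_derivative\<close> is an
  arbitrary value where no derivative exists.\<close>

primrec C_k :: "nat \<Rightarrow> (real^'n::finite \<Rightarrow> real) \<Rightarrow> bool" where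
  "C_k 0 u \<longleftrightarrow> continuous_on UNIV u"
| "C_k (Suc k) u \<longleftrightarrow> (\<forall>x. u differentiable (at x)) \<and> (\<forall>i. C_k k (pderivative i u))"

text \<open>For open \<open>\<Omega>\<close>, elements of \<open>C\<^sup>1\<^sub>c(\<Omega>)\<close> are represented by their extensions by zero
  to the whole space.\<close>

definition C1c :: "(real^'n::finite) set \<Rightarrow> (real^'n \<Rightarrow> real) set" where
  "C1c \<Omega> = {\<phi>. C_k 1 \<phi> \<and> compact (closure {x. \<phi> x \<noteq> 0}) \<and> closure {x. \<phi> x \<noteq> 0} \<subseteq> \<Omega>}"

definition C2_solution :: "(real \<Rightarrow> real) \<Rightarrow> (real^'n::finite \<Rightarrow> real) \<Rightarrow> bool" where
  "C2_solution f u \<longleftrightarrow> C_k 2 u \<and> (\<forall>x. - laplacian u x = f (u x))"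

definition stability_inequality ::
  "(real \<Rightarrow> real) \<Rightarrow> (real^'n::finite \<Rightarrow> real) \<Rightarrow> (real^'n \<Rightarrow> real) \<Rightarrow> bool" where
  "stability_inequality f u \<phi> \<longleftrightarrow>
     (\<integral>x. deriv f (u x) * (\<phi> x)\<^sup>2 \<partial>lborel) \<le> (\<integral>x. (norm (grad \<phi> x))\<^sup>2 \<partial>lborel)"

definition is_stable :: "(real \<Rightarrow> real) \<Rightarrow> (real^'n::finite \<Rightarrow> real) \<Rightarrow> bool" where
  "is_stable f u \<longleftrightarrow> (\<forall>\<phi>\<in>C1c UNIV. stability_inequality f u \<phi>)"

definition stable_outside_compact :: "(real \<Rightarrow> real) \<Rightarrow> (real^'n::finite \<Rightarrow> real) \<Rightarrow> bool" where
  "stable_outside_compact f u \<longleftrightarrow>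
     (\<exists>K. compact K \<and> (\<forall>\<phi>\<in>C1c (- K). stability_inequality f u \<phi>))"

end

theory Submission
  imports Defs "HOL-Complex_Analysis.Great_Picard"
begin

text \<open>If \<open>u\<close> does not tend to \<open>0\<close>, then \<open>\<bar>u (a\<^sub>n)\<bar> \<ge> e\<close> along points \<open>a\<^sub>n\<close> that tend to
  infinity. A subsequence of the translates \<open>u (\<cdot> + a\<^sub>n)\<close> converges to a bounded \<open>C\<^sup>2\<close> solution \<open>v\<close>
  with \<open>\<bar>v 0\<bar> \<ge> e\<close>, and \<open>v\<close> is stable because the exceptional compact set is translated away from the
  support of any given test function. Compactness up to second derivatives uses neither
  Hoelder estimates nor potential theory: the maximum principle gives
  \<open>sup \<bar>\<nabla>w\<bar> \<le> C (sup \<bar>w\<bar> + sup \<bar>\<Delta>w\<bar>)\<close> on the whole space, and this one estimate is applied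
  to \<open>u\<close>, to its increments and to its second increments.\<close>

section \<open>Gradients and Hessians as explicit data\<close>

text \<open>Carrying \<open>g\<close> and \<open>H\<close> as functions gives translates, increments
  and limits of a solution explicit formulas for their derivatives; \<open>trace (H x)\<close> then
  plays the part of the Laplacian.\<close>

definition has_grad_hessian ::
  "(real^'n::finite \<Rightarrow> real) \<Rightarrow> (real^'n \<Rightarrow> real^'n) \<Rightarrow> (real^'n \<Rightarrow> real^'n^'n) \<Rightarrow> bool" where
  "has_grad_hessian w g H \<longleftrightarrow>
     (\<forall>x. (w has_derivative (\<lambda>h. g x \<bullet> h)) (at x) \<and> (g has_derivative (\<lambda>h. H x *v h)) (at x))"

lemma has_grad_hessianD:
  assumes "has_grad_hessian w g H"
  shows "(w has_derivative (\<lambda>h. g x \<bullet> h)) (at x)" "(g has_derivative (\<lambda>h. H x *v h)) (at x)"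
  using assms by (auto simp: has_grad_hessian_def)

lemma has_grad_hessian_translate:
  assumes "has_grad_hessian w g H"
  shows "has_grad_hessian (\<lambda>x. w (x + a)) (\<lambda>x. g (x + a)) (\<lambda>x. H (x + a))"
  unfolding has_grad_hessian_def
proof (intro allI conjI)
  fix x
  have t: "((\<lambda>x. x + a) has_derivative (\<lambda>h. h)) (at x)"
    by (auto intro!: derivative_eq_intros)
  show "((\<lambda>x. w (x + a)) has_derivative (\<lambda>h. g (x + a) \<bullet> h)) (at x)"
    using has_derivative_compose[OF t has_grad_hessianD(1)[OF assms]] .
  show "((\<lambda>x. g (x + a)) has_derivative (\<lambda>h. H (x + a) *v h)) (at x)"
    using has_derivative_compose[OF t has_grad_hessianD(2)[OF assms]] .
qed

lemma has_grad_hessian_diff: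
  assumes "has_grad_hessian w g H" "has_grad_hessian w' g' H'"
  shows "has_grad_hessian (\<lambda>x. w x - w' x) (\<lambda>x. g x - g' x) (\<lambda>x. H x - H' x)"
  using assms unfolding has_grad_hessian_def inner_diff_left matrix_vector_mult_diff_rdistrib
  by (auto intro: has_derivative_diff)

lemma has_grad_hessian_minus:
  fixes w :: "real^'n::finite \<Rightarrow> real"
  assumes "has_grad_hessian w g H"
  shows "has_grad_hessian (\<lambda>x. - w x) (\<lambda>x. - g x) (\<lambda>x. - H x)"
proof -
  have "(*v) (- A) = (\<lambda>h. - (A *v h))" for A :: "real^'n^'n"
    using matrix_vector_mult_diff_rdistrib[of 0 A] by auto
  then show ?thesis
    using assms unfolding has_grad_hessian_def inner_minus_left
    by (auto intro: has_derivative_minus)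
qed

lemma has_grad_hessian_line:
  assumes "has_grad_hessian w g H"
  shows "((\<lambda>t. w (a + t *\<^sub>R v)) has_real_derivative g (a + t *\<^sub>R v) \<bullet> v) (at t)"
    and "((\<lambda>t. g (a + t *\<^sub>R v) \<bullet> v) has_real_derivative (H (a + t *\<^sub>R v) *v v) \<bullet> v) (at t)"
proof -
  have t: "((\<lambda>t. a + t *\<^sub>R v) has_derivative (\<lambda>s. s *\<^sub>R v)) (at t)"
    by (auto intro!: derivative_eq_intros)
  have "((\<lambda>t. w (a + t *\<^sub>R v)) has_derivative (\<lambda>s. g (a + t *\<^sub>R v) \<bullet> (s *\<^sub>R v))) (at t)"
    using has_derivative_compose[OF t has_grad_hessianD(1)[OF assms]] .
  then show "((\<lambda>t. w (a + t *\<^sub>R v)) has_real_derivative g (a + t *\<^sub>R v) \<bullet> v) (at t)"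
    unfolding has_field_derivative_def by (rule has_derivative_eq_rhs) (auto simp: mult.commute)
  have "((\<lambda>t. g (a + t *\<^sub>R v)) has_derivative (\<lambda>s. H (a + t *\<^sub>R v) *v (s *\<^sub>R v))) (at t)"
    using has_derivative_compose[OF t has_grad_hessianD(2)[OF assms]] .
  from has_derivative_inner_left[OF this, of v]
  show "((\<lambda>t. g (a + t *\<^sub>R v) \<bullet> v) has_real_derivative (H (a + t *\<^sub>R v) *v v) \<bullet> v) (at t)"
    unfolding has_field_derivative_def
    by (rule has_derivative_eq_rhs) (auto simp: matrix_vector_mult_scaleR mult.commute)
qed

section \<open>The global gradient estimate by the maximum principle\<close>

lemma trace_minus: "trace (- A) = - trace (A :: real^'n::finite^'n)"
  by (simp add: trace_def sum_negf)

lemma inner_matrix_vector_axis: "(A *v axis j 1) \<bullet> axis j 1 = (A $ j $ j :: real)"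
  by (simp add: inner_axis matrix_vector_mul_component)

text \<open>Fermat's rule gives \<open>s' 0 = 0\<close>. If \<open>c\<close> were positive,
  \<open>s'\<close> would be positive just to the right of 0 and \<open>s\<close> would rise above
  its maximum.\<close>

lemma second_derivative_nonpos_at_local_max:
  fixes s :: "real \<Rightarrow> real"
  assumes s: "\<And>t. (s has_real_derivative s' t) (at t)"
    and s': "(s' has_real_derivative c) (at 0)"
    and "0 < d" and max: "\<And>t. \<bar>t\<bar> < d \<Longrightarrow> s t \<le> s 0"
  shows "c \<le> 0"
proof (rule ccontr)
  assume "\<not> c \<le> 0"
  have s0: "s' 0 = 0"
    by (rule DERIV_local_max[OF s \<open>0 < d\<close>]) (simp add: max)
  obtain r where r: "r > 0" "\<And>h. h > 0 \<Longrightarrow> h < r \<Longrightarrow> 0 < s' h"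
    using DERIV_pos_inc_right[OF s'] \<open>\<not> c \<le> 0\<close> s0 by auto
  define b where "b = min d r / 2"
  have b: "0 < b" "b < d" "b < r" using \<open>0 < d\<close> r(1) by (auto simp: b_def)
  have "s 0 < s b"
  proof (rule DERIV_pos_imp_increasing_open[OF b(1)])
    show "\<exists>y. (s has_real_derivative y) (at x) \<and> 0 < y" if "0 < x" "x < b" for x
      using s[of x] r(2)[of x] that b by auto
    show "continuous_on {0..b} s"
      using s DERIV_isCont continuous_at_imp_continuous_on by blast
  qed
  with max[of b] b show False by simp
qed

text \<open>Serves to end the barrier argument: a comparison along a segment whose two sides agree
  at its starting point becomes a comparison of derivatives there.\<close>

lemma has_real_derivative_nonneg_right:
  fixes q :: "real \<Rightarrow> real"
  assumes "(q has_real_derivative c) (at 0)" "q 0 = 0" and "\<And>t. 0 < t \<Longrightarrow> t \<le> 1 \<Longrightarrow> 0 \<le> q t"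
  shows "0 \<le> c"
proof (rule ccontr)
  assume "\<not> 0 \<le> c"
  then obtain d where d: "d > 0" "\<And>h. h > 0 \<Longrightarrow> h < d \<Longrightarrow> q h < 0"
    using DERIV_neg_dec_right[OF assms(1)] assms(2) by auto
  have "q (min d 1 / 2) < 0" using d by auto
  moreover have "0 \<le> q (min d 1 / 2)" using d by (intro assms(3)) auto
  ultimately show False by simp
qed

text \<open>The odd part of \<open>w\<close> under reflection in the hyperplane through \<open>x\<close> orthogonal to the
  \<open>i\<close>-th axis vanishes on that hyperplane, so on a half cube it can be compared with a strict
  supersolution that vanishes at \<open>x\<close> and dominates \<open>2 M\<close> on the other faces.\<close>

lemma partial_derivative_upper_bound:
  fixes w :: "real^'n::finite \<Rightarrow> real"
  assumes w: "has_grad_hessian w g H"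
    and M: "\<And>x. \<bar>w x\<bar> \<le> M" and F: "\<And>x. \<bar>trace (H x)\<bar> \<le> F" and "0 < F"
  shows "g x $ i \<le> (real CARD('n) + 1) * M + F"
proof -
  define n where "n = real CARD('n)"
  \<comment> \<open>The barrier subtracted in \<open>Phi\<close> has Laplacian
    \<open>4 * M * n - 2 * A = - 4 * F\<close> with this choice. The odd part has Laplacian at least
    \<open>- 2 * F\<close>, so the Laplacian of \<open>Phi\<close> is at least
    \<open>2 * F > 0\<close> and no interior maximum is possible.\<close>
  define A where "A = 2 * M * n + 2 * F"
  define e :: "real^'n" where "e = axis i 1"
  define R where "R y = y - (2 * y $ i) *\<^sub>R e" for y :: "real^'n"
  define Phi where
    "Phi y = w (x + y) - w (x + R y) - (2 * M * (y \<bullet> y) + A * (y $ i * (1 - y $ i)))" for y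
  have M0: "0 \<le> M" using M[of 0] by simp
  have A0: "0 \<le> A" using M0 \<open>0 < F\<close> by (simp add: A_def n_def)
  have w2M: "w a - w b \<le> 2 * M" for a b using M[of a] M[of b] by linarith
  \<comment> \<open>\<open>Q\<close> is the half cube with i-th coordinate in [0, 1] and all others
    in [-1, 1]. Its face with \<open>y $ i = 0\<close> is fixed by \<open>R\<close>.\<close>
  define a where "a = (\<chi> j. if j = i then 0 else - (1 :: real))"
  define Q where "Q = cbox a (1 :: real^'n)"
  have Qi: "0 \<le> y $ i" "y $ i \<le> 1" if "y \<in> Q" for y
    using that by (auto simp: Q_def a_def mem_box_cart dest!: spec[of _ i])
  have Qj: "\<bar>y $ j\<bar> \<le> 1" if "y \<in> Q" for y j
    using that by (cases "j = i") (auto simp: Q_def a_def mem_box_cart abs_le_iff split: if_splits dest!: spec[of _ j])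
  have contw: "continuous_on UNIV w"
    using has_grad_hessianD(1)[OF w] has_derivative_continuous continuous_at_imp_continuous_on by blast
  have contR: "continuous_on S R" for S
    unfolding R_def by (intro continuous_intros)
  have "continuous_on Q Phi"
    unfolding Phi_def
    by (intro continuous_intros continuous_on_compose2[OF contw] contR) auto
  moreover have "compact Q" "0 \<in> Q" by (auto simp: Q_def a_def mem_box_cart)
  ultimately obtain z where z: "z \<in> Q" "\<And>y. y \<in> Q \<Longrightarrow> Phi y \<le> Phi z"
    using continuous_attains_sup[of Q Phi] by blast
  \<comment> \<open>\<open>Phi\<close> is nonpositive on every face, so a positive maximum would lie
    in the open half cube, where the sign of the Laplacian forbids it.\<close>
  have "Phi z \<le> 0"
  proof (rule ccontr)
    assume "\<not> Phi z \<le> 0"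
    then have pos: "0 < Phi z" by simp
    have base: "0 \<le> A * (z $ i * (1 - z $ i))" using A0 Qi[OF z(1)] by simp
    have zi0: "z $ i \<noteq> 0"
    proof
      assume "z $ i = 0"
      then have "Phi z = - (2 * M * (z \<bullet> z))" by (simp add: Phi_def R_def)
      also have "\<dots> \<le> 0" using M0 by simp
      finally show False using pos by simp
    qed
    \<comment> \<open>A coordinate of modulus 1 makes \<open>z \<bullet> z\<close> at least 1, so
      the quadratic term alone covers \<open>2 * M\<close>, the largest possible value of the odd
      part. The case \<open>j = i\<close> treats the face opposite to the fixed one.\<close>
    have zj1: "\<bar>z $ j\<bar> < 1" for j
    proof (rule ccontr)
      assume "\<not> \<bar>z $ j\<bar> < 1"
      then have "1 \<le> norm z" using component_le_norm_cart[of z j] by linarith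
      then have "1 \<le> z \<bullet> z"
        by (metis one_le_power power2_norm_eq_inner)
      then have "2 * M \<le> 2 * M * (z \<bullet> z)" using M0 by (simp add: mult_le_cancel_left1)
      then show False using pos base w2M[of "x + z" "x + R z"] by (simp add: Phi_def)
    qed
    have "a $ j < z $ j \<and> z $ j < 1" for j
      using Qi(1)[OF z(1)] zi0 zj1[of j] by (auto simp: a_def abs_less_iff)
    then have "z \<in> box a 1" by (simp add: mem_box_cart)
    then obtain d where d: "d > 0" "ball z d \<subseteq> box a 1"
      using open_contains_ball open_box by metis
    then have dQ: "ball z d \<subseteq> Q" using box_subset_cbox unfolding Q_def by blast
    \<comment> \<open>Second derivative test for \<open>Phi\<close> along the j-th axis. The
      reflected point moves in direction \<open>R v\<close>, which is \<open>v\<close> or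
      \<open>- v\<close>; the quadratic form of \<open>H\<close> does not see this sign. The barrier
      contributes \<open>4 * M\<close> in each direction and \<open>- 2 * A\<close> only for
      \<open>j = i\<close>.\<close>
    have second: "H (x + z) $ j $ j - H (x + R z) $ j $ j - (4 * M - (if j = i then 2 * A else 0)) \<le> 0" for j
    proof -
      define v :: "real^'n" where "v = axis j 1"
      define v' where "v' = R v"
      \<comment> \<open>The i-th component of the direction \<open>v\<close>; it lets one formula
        cover both \<open>j = i\<close> and the other axes.\<close>
      define b where "b = (if j = i then 1 else 0 :: real)"
      have v': "v' = (if j = i then - v else v)"
        by (auto simp: v'_def R_def v_def e_def axis_def vec_eq_iff)
      have Rv: "R (z + t *\<^sub>R v) = R z + t *\<^sub>R v'" for t
        by (simp add: R_def v'_def algebra_simps scaleR_add_left)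
      have vi: "v $ i = b" by (auto simp: v_def b_def axis_def)
      have quad: "H (x + R z) $ j $ j = (H (x + R z) *v v') \<bullet> v'"
        using inner_matrix_vector_axis[of "H (x + R z)" j]
          linear_neg[OF matrix_vector_mul_linear[of "H (x + R z)"], of v]
        by (cases "j = i") (simp_all add: v' v_def)
      have vv: "v \<bullet> v = 1" by (simp add: v_def inner_axis_axis)
      have PhiE: "Phi (z + t *\<^sub>R v) = w (x + z + t *\<^sub>R v) - w (x + R z + t *\<^sub>R v')
          - (2 * M * (z \<bullet> z + 2 * t * (z \<bullet> v) + t\<^sup>2) + A * ((z $ i + t * b) * (1 - (z $ i + t * b))))" for t
      proof -
        have "(z + t *\<^sub>R v) \<bullet> (z + t *\<^sub>R v) = z \<bullet> z + 2 * t * (z \<bullet> v) + t\<^sup>2"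
          by (simp add: inner_add_left inner_add_right vv inner_commute[of v z] power2_eq_square distrib_left)
        moreover have "(z + t *\<^sub>R v) $ i = z $ i + t * b" by (simp add: vi)
        moreover have "x + (z + t *\<^sub>R v) = x + z + t *\<^sub>R v" "x + (R z + t *\<^sub>R v') = x + R z + t *\<^sub>R v'"
          by simp_all
        ultimately show ?thesis by (simp only: Phi_def Rv)
      qed
      define s' where "s' t = g (x + z + t *\<^sub>R v) \<bullet> v - g (x + R z + t *\<^sub>R v') \<bullet> v'
          - (2 * M * (2 * (z \<bullet> v) + 2 * t) + A * (b * (1 - (z $ i + t * b)) - (z $ i + t * b) * b))" for t
      have "(H (x + z) *v v) \<bullet> v - (H (x + R z) *v v') \<bullet> v' - (4 * M - A * (2 * b * b)) \<le> 0"
      proof (rule second_derivative_nonpos_at_local_max[where s="\<lambda>t. Phi (z + t *\<^sub>R v)" and s' = s'])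
        show "((\<lambda>t. Phi (z + t *\<^sub>R v)) has_real_derivative s' t) (at t)" for t
          unfolding PhiE s'_def
          by (rule has_grad_hessian_line(1)[OF w] derivative_eq_intros refl)+ (simp add: algebra_simps)
        show "(s' has_real_derivative (H (x + z) *v v) \<bullet> v - (H (x + R z) *v v') \<bullet> v' - (4 * M - A * (2 * b * b))) (at 0)"
          unfolding s'_def
          by (rule has_grad_hessian_line(2)[OF w, where t = 0, simplified] derivative_eq_intros refl)+ (simp add: algebra_simps)
        show "0 < d" by fact
        show "Phi (z + t *\<^sub>R v) \<le> Phi (z + 0 *\<^sub>R v)" if "\<bar>t\<bar> < d" for t
          using that dQ by (auto intro!: z(2) simp: dist_norm v_def subset_eq)
      qed
      moreover have "(H (x + z) *v v) \<bullet> v = H (x + z) $ j $ j"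
        by (simp add: v_def inner_matrix_vector_axis)
      moreover have "A * (2 * b * b) = (if j = i then 2 * A else 0)"
        by (simp add: b_def)
      ultimately show ?thesis using quad by simp
    qed
    have "(\<Sum>j\<in>UNIV. H (x + z) $ j $ j - H (x + R z) $ j $ j - (4 * M - (if j = i then 2 * A else 0))) \<le> 0"
      by (intro sum_nonpos second)
    then have "trace (H (x + z)) - trace (H (x + R z)) - (4 * M * n - 2 * A) \<le> 0"
      by (simp add: trace_def sum_subtractf n_def sum.delta mult.commute)
    then show False
      using F[of "x + z"] F[of "x + R z"] \<open>0 < F\<close> by (simp add: A_def)
  qed
  then have Phi_le: "Phi y \<le> 0" if "y \<in> Q" for y using z(2)[OF that] by simp
  have ei: "e $ i = 1" "e \<bullet> e = 1" by (auto simp: e_def inner_axis_axis)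
  have Re: "R (t *\<^sub>R e) = t *\<^sub>R (- e)" for t
    by (simp add: R_def ei algebra_simps flip: scaleR_add_left)
  \<comment> \<open>On \<open>t *\<^sub>R e\<close> with \<open>0 < t \<le> 1\<close> the barrier is
    at most \<open>(2 * M + A) * t\<close>, with equality of both sides at 0. The odd part has slope
    \<open>2 * (g x $ i)\<close> there, and half of \<open>2 * M + A\<close> is the claimed
    bound.\<close>
  have "0 \<le> (2 * M + A) - (g x \<bullet> e - g x \<bullet> (- e))"
  proof (rule has_real_derivative_nonneg_right[where
        q = "\<lambda>t. (2 * M + A) * t - (w (x + t *\<^sub>R e) - w (x + t *\<^sub>R (- e)))"])
    show "((\<lambda>t. (2 * M + A) * t - (w (x + t *\<^sub>R e) - w (x + t *\<^sub>R (- e))))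
        has_real_derivative (2 * M + A) - (g x \<bullet> e - g x \<bullet> (- e))) (at 0)"
      using has_grad_hessian_line(1)[OF w, of x e 0] has_grad_hessian_line(1)[OF w, of x "- e" 0]
      by (intro DERIV_diff) (auto intro!: derivative_eq_intros)
    show "0 \<le> (2 * M + A) * t - (w (x + t *\<^sub>R e) - w (x + t *\<^sub>R (- e)))" if t: "0 < t" "t \<le> 1" for t
    proof -
      have "t *\<^sub>R e \<in> Q" using t by (auto simp: Q_def a_def e_def mem_box_cart axis_def)
      from Phi_le[OF this] have
        "w (x + t *\<^sub>R e) - w (x + t *\<^sub>R (- e)) \<le> 2 * M * (t * t) + A * (t * (1 - t))"
        unfolding Phi_def Re by (simp add: ei)
      also have "\<dots> \<le> 2 * M * t + A * t"
        using t M0 A0 by (intro add_mono mult_left_mono) (auto simp: mult_le_cancel_left1 mult_left_le)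
      finally show ?thesis by (simp add: algebra_simps)
    qed
  qed simp
  moreover have "g x \<bullet> e = g x $ i" by (simp add: e_def inner_axis)
  ultimately show ?thesis by (simp add: A_def n_def algebra_simps)
qed

text \<open>The one-sided bound is applied to \<open>w\<close> and \<open>- w\<close> in each
  coordinate. It requires a positive \<open>F\<close>, hence the enlargement by \<open>e\<close>,
  which is then removed. Linearity of the bound in \<open>M + F\<close> is what makes it useful for
  increments: if both quantities are of order \<open>norm k\<close>, so is the gradient.\<close>

lemma gradient_bound:
  fixes w :: "real^'n::finite \<Rightarrow> real"
  assumes w: "has_grad_hessian w g H"
    and M: "\<And>x. \<bar>w x\<bar> \<le> M" and F: "\<And>x. \<bar>trace (H x)\<bar> \<le> F"
  shows "norm (g x) \<le> real CARD('n) * (real CARD('n) + 1) * (M + F)"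
proof -
  have F0: "0 \<le> F" using F[of 0] by linarith
  have comp: "\<bar>g x $ i\<bar> \<le> (real CARD('n) + 1) * (M + F)" for i
  proof -
    have "\<bar>g x $ i\<bar> \<le> (real CARD('n) + 1) * M + F"
    proof (rule field_le_epsilon)
      fix e :: real assume "0 < e"
      have F': "\<bar>trace (H x)\<bar> \<le> F + e" for x using F[of x] \<open>0 < e\<close> by linarith
      have "g x $ i \<le> (real CARD('n) + 1) * M + (F + e)"
        by (rule partial_derivative_upper_bound[OF w M F']) (use F0 \<open>0 < e\<close> in auto)
      moreover have "(- g x) $ i \<le> (real CARD('n) + 1) * M + (F + e)"
        by (rule partial_derivative_upper_bound[OF has_grad_hessian_minus[OF w]])
          (use F0 \<open>0 < e\<close> M F' in \<open>auto simp: trace_minus\<close>)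
      ultimately show "\<bar>g x $ i\<bar> \<le> (real CARD('n) + 1) * M + F + e" by simp
    qed
    also have "\<dots> \<le> (real CARD('n) + 1) * (M + F)" using F0 by (simp add: algebra_simps)
    finally show ?thesis .
  qed
  have "norm (g x) \<le> (\<Sum>i\<in>UNIV. \<bar>g x $ i\<bar>)" by (rule norm_le_l1_cart)
  also have "\<dots> \<le> (\<Sum>i\<in>(UNIV::'n set). (real CARD('n) + 1) * (M + F))"
    by (intro sum_mono comp)
  finally show ?thesis by (simp add: mult.assoc)
qed

section \<open>Uniform bounds and moduli of continuity up to second derivatives\<close>

lemma lipschitz_of_derivative_bound:
  fixes G :: "'a::euclidean_space \<Rightarrow> 'b::real_normed_vector"
  assumes "\<And>x. (G has_derivative D x) (at x)" "\<And>x h. norm (D x h) \<le> B * norm h"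
  shows "norm (G (x + k) - G x) \<le> B * norm k"
proof -
  have "norm (G (x + k) - G x) \<le> B * norm (x + k - x)"
    using assms by (intro differentiable_bound[of UNIV G D]) (auto intro: onorm_le has_derivative_at_withinI)
  then show ?thesis by simp
qed

text \<open>Recovers information on the Hessian from the gradient estimate, which by itself only
  yields Lipschitz constants of gradients. The derivative is tested on a short multiple of
  \<open>h\<close> and rescaled.\<close>

lemma derivative_bound_of_lipschitz:
  fixes G :: "'a::real_normed_vector \<Rightarrow> 'b::real_normed_vector"
  assumes D: "(G has_derivative D) (at x)" and lip: "\<And>k. norm (G (x + k) - G x) \<le> B * norm k"
  shows "norm (D h) \<le> B * norm h"
proof (cases "h = 0")
  case True
  then show ?thesis using D by (simp add: has_derivative_def linear_simps)
next
  case False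
  interpret bounded_linear D using D by (simp add: has_derivative_def)
  show ?thesis
  proof (rule field_le_epsilon)
    fix e :: real assume "0 < e"
    then have e': "0 < e / norm h" using False by simp
    then obtain d where d: "d > 0"
      "\<And>y. norm (y - x) < d \<Longrightarrow> norm (G y - G x - D (y - x)) \<le> e / norm h * norm (y - x)"
      using D unfolding has_derivative_at_alt by blast
    define t where "t = d / (2 * norm h)"
    have t: "t > 0" "norm (t *\<^sub>R h) < d" using d(1) False by (auto simp: t_def)
    have "norm (D (t *\<^sub>R h)) \<le> norm (G (x + t *\<^sub>R h) - G x) + norm (G (x + t *\<^sub>R h) - G x - D (t *\<^sub>R h))"
      by (metis norm_minus_commute norm_triangle_sub)
    also have "\<dots> \<le> B * norm (t *\<^sub>R h) + e / norm h * norm (t *\<^sub>R h)"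
      using lip[of "t *\<^sub>R h"] d(2)[of "x + t *\<^sub>R h"] t by (intro add_mono) auto
    also have "\<dots> = t * (B * norm h + e)" using t(1) False by (simp add: field_simps)
    finally have "t * norm (D h) \<le> t * (B * norm h + e)" using t(1) by (simp add: scale)
    then show "norm (D h) \<le> B * norm h + e" using t(1) by simp
  qed
qed

text \<open>The norm of \<open>real^'n^'n\<close> is the Frobenius norm, whereas the Hessian
  estimates are operator bounds. Each entry is at most \<open>e\<close>, and summing all entries
  gives the square of the dimension.\<close>

lemma norm_matrix_le:
  fixes A :: "real^'n::finite^'n"
  assumes "\<And>h. norm (A *v h) \<le> e * norm h"
  shows "norm A \<le> (real CARD('n))\<^sup>2 * e"
proof -
  have comp: "\<bar>A $ i $ j\<bar> \<le> e" for i j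
  proof -
    have "A $ i $ j = (A *v axis j 1) $ i"
      by (simp add: matrix_vector_mul_component inner_axis)
    also have "\<bar>\<dots>\<bar> \<le> norm (A *v axis j 1)" by (rule component_le_norm_cart)
    also have "\<dots> \<le> e" using assms[of "axis j 1"] by simp
    finally show ?thesis .
  qed
  have "norm A \<le> (\<Sum>i\<in>UNIV. norm (A $ i))"
    unfolding norm_vec_def[of A] by (intro L2_set_le_sum) auto
  also have "\<dots> \<le> (\<Sum>i\<in>(UNIV::'n set). \<Sum>j\<in>(UNIV::'n set). e)"
    by (intro sum_mono order_trans[OF norm_le_l1_cart] comp)
  finally show ?thesis by (simp add: power2_eq_square)
qed

text \<open>Three uses of the gradient estimate. For \<open>u\<close> it bounds \<open>g\<close>.
  For an increment of \<open>u\<close> by \<open>k\<close>, whose size and Laplacian are of order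
  \<open>norm k\<close>, it makes \<open>g\<close> Lipschitz and so bounds \<open>H\<close>. For the
  increment by \<open>k\<close> of an increment by a small \<open>l\<close>, both quantities are a
  small multiple of \<open>norm k\<close>, because \<open>f'\<close> is uniformly continuous on the
  values of \<open>u\<close>; this makes \<open>H\<close> uniformly continuous.\<close>

lemma semilinear_solution_regularity:
  fixes u :: "real^'n::finite \<Rightarrow> real" and f f' :: "real \<Rightarrow> real"
  assumes u: "has_grad_hessian u g H" and eq: "\<And>x. trace (H x) = - f (u x)"
    and f: "\<And>y. (f has_real_derivative f' y) (at y)" and f': "continuous_on UNIV f'"
    and bdd: "bounded (range u)"
  obtains B where "\<And>x. norm (g x) \<le> B" "\<And>x h. norm (H x *v h) \<le> B * norm h"
    "\<And>x k. norm (u (x + k) - u x) \<le> B * norm k"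
    "\<And>x k. norm (g (x + k) - g x) \<le> B * norm k"
    "\<And>e. 0 < e \<Longrightarrow> \<exists>d>0. \<forall>x l h. norm l < d \<longrightarrow> norm (H (x + l) *v h - H x *v h) \<le> e * norm h"
proof -
  obtain M where M: "\<And>x. \<bar>u x\<bar> \<le> M" using bdd by (auto simp: bounded_iff)
  define I where "I = {- M..M}"
  have uI: "u x \<in> I" for x using M[of x] by (auto simp: I_def abs_le_iff)
  have "compact I" by (simp add: I_def)
  have f'I: "continuous_on I f'" using f' continuous_on_subset by blast
  have fI: "continuous_on I f"
    using f DERIV_isCont continuous_at_imp_continuous_on by blast
  obtain L where L: "\<And>y. y \<in> I \<Longrightarrow> \<bar>f' y\<bar> \<le> L"
    using compact_imp_bounded[OF compact_continuous_image[OF f'I \<open>compact I\<close>]]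
    by (auto simp: bounded_iff)
  obtain F where F: "\<And>y. y \<in> I \<Longrightarrow> \<bar>f y\<bar> \<le> F"
    using compact_imp_bounded[OF compact_continuous_image[OF fI \<open>compact I\<close>]]
    by (auto simp: bounded_iff)
  have uc: "uniformly_continuous_on I f'"
    by (rule compact_uniformly_continuous[OF f'I \<open>compact I\<close>])
  define C where "C = real CARD('n) * (real CARD('n) + 1)"
  have C0: "0 < C" by (simp add: C_def add_pos_pos)
  have M0: "0 \<le> M" using M[of 0] by linarith
  have F0: "0 \<le> F" using F[OF uI[of 0]] by linarith
  have L0: "0 \<le> L" using L[OF uI[of 0]] by linarith
  define B1 where "B1 = C * (M + F)"
  have B1: "norm (g x) \<le> B1" for x
    unfolding B1_def C_def
    by (rule gradient_bound[OF u M]) (use F[OF uI] eq in simp)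
  have B10: "0 \<le> B1" using C0 M0 F0 by (simp add: B1_def)
  note du = has_grad_hessianD(1)[OF u]
  have ulip: "norm (u (x + k) - u x) \<le> B1 * norm k" for x k
    by (rule lipschitz_of_derivative_bound[OF du])
      (use B1 in \<open>metis Cauchy_Schwarz_ineq2 mult_right_mono norm_ge_zero order_trans real_norm_def\<close>)
  \<comment> \<open>The gradient of \<open>f (u x)\<close>. Its bound controls increments of the
    Laplacian of \<open>u\<close>, and its modulus of continuity controls second increments.\<close>
  define p where "p x = f' (u x) *\<^sub>R g x" for x
  have dfu: "((\<lambda>x. f (u x)) has_derivative (\<lambda>h. p x \<bullet> h)) (at x)" for x
    using has_derivative_compose[OF du[of x] f[of "u x", unfolded has_field_derivative_def]]
    by (simp add: p_def)
  have normp: "norm (p x) \<le> L * B1" for x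
    unfolding p_def using B1[of x] L[OF uI[of x]] L0 by (simp add: mult_mono)
  have fulip: "norm (f (u (x + k)) - f (u x)) \<le> L * B1 * norm k" for x k
    by (rule lipschitz_of_derivative_bound[OF dfu])
      (use normp in \<open>metis Cauchy_Schwarz_ineq2 mult_right_mono norm_ge_zero order_trans real_norm_def\<close>)
  define B2 where "B2 = C * (B1 + L * B1)"
  have glip: "norm (g (x + k) - g x) \<le> B2 * norm k" for x k
  proof -
    have "norm (g (x + k) - g x) \<le> C * (B1 * norm k + L * B1 * norm k)"
      unfolding C_def
    proof (rule gradient_bound[OF has_grad_hessian_diff[OF has_grad_hessian_translate[OF u] u]])
      show "\<bar>u (y + k) - u y\<bar> \<le> B1 * norm k" for y using ulip[of y k] by simp
      show "\<bar>trace (H (y + k) - H y)\<bar> \<le> L * B1 * norm k" for y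
        using fulip[of y k] by (simp add: trace_sub eq abs_minus_commute)
    qed
    then show ?thesis by (simp add: B2_def algebra_simps)
  qed
  have B20: "0 \<le> B2" using C0 B10 L0 by (simp add: B2_def)
  have Hbd: "norm (H x *v h) \<le> B2 * norm h" for x h
    by (rule derivative_bound_of_lipschitz[OF has_grad_hessianD(2)[OF u] glip])
  have Huc: "\<exists>d>0. \<forall>x l h. norm l < d \<longrightarrow> norm (H (x + l) *v h - H x *v h) \<le> e * norm h"
    if "0 < e" for e
  proof -
    \<comment> \<open>The last use of the gradient estimate has \<open>e1 * norm k\<close> both as
      size and as Laplacian bound, so it returns \<open>C * (2 * e1) * norm k\<close>.\<close>
    define e1 where "e1 = e / (2 * C)"
    have e1: "0 < e1" using that C0 by (simp add: e1_def)
    have "0 < e1 / (2 * (B1 + 1))" using e1 B10 by simp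
    then obtain r where r: "r > 0"
      "\<And>y z. y \<in> I \<Longrightarrow> z \<in> I \<Longrightarrow> dist z y < r \<Longrightarrow> dist (f' z) (f' y) < e1 / (2 * (B1 + 1))"
      using uc unfolding uniformly_continuous_on_def by blast
    \<comment> \<open>The first bound moves \<open>u\<close> by less than \<open>r\<close>, the
      second moves \<open>g\<close> by at most \<open>e1\<close>, and the third keeps
      \<open>L\<close> times the change of \<open>g\<close> below \<open>e1 / 2\<close>. The added
      ones keep denominators positive.\<close>
    define d where "d = min (r / (B1 + 1)) (min (e1 / (B2 + 1)) (e1 / (2 * (L * B2 + 1))))"
    have "0 < d" using r(1) e1 B10 B20 L0 by (auto simp: d_def add_nonneg_pos)
    moreover have "norm (H (x + l) *v h - H x *v h) \<le> e * norm h" if l: "norm l < d" for x l h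
    proof -
      have l1: "B1 * norm l < r"
      proof -
        have "B1 * norm l \<le> (B1 + 1) * norm l" by (simp add: algebra_simps)
        also have "\<dots> < r" using l B10 by (simp add: d_def pos_less_divide_eq mult.commute)
        finally show ?thesis .
      qed
      have l2: "B2 * norm l \<le> e1"
      proof -
        have "B2 * norm l \<le> (B2 + 1) * norm l" by (simp add: algebra_simps)
        also have "\<dots> < e1" using l B20 by (simp add: d_def pos_less_divide_eq mult.commute)
        finally show ?thesis by simp
      qed
      have l3: "L * (B2 * norm l) \<le> e1 / 2"
      proof -
        have pos: "0 < 2 * (L * B2 + 1)" using B20 L0 by (simp add: add_nonneg_pos)
        have "2 * (L * (B2 * norm l)) \<le> (2 * (L * B2 + 1)) * norm l" by (simp add: algebra_simps)
        also have "\<dots> < e1" using l pos by (simp add: d_def pos_less_divide_eq mult.commute)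
        finally show ?thesis by simp
      qed
      have pl: "norm (p (y + l) - p y) \<le> e1" for y
      proof -
        have "p (y + l) - p y = (f' (u (y + l)) - f' (u y)) *\<^sub>R g (y + l) + f' (u y) *\<^sub>R (g (y + l) - g y)"
          by (simp add: p_def algebra_simps)
        also have "norm \<dots> \<le> \<bar>f' (u (y + l)) - f' (u y)\<bar> * norm (g (y + l)) + \<bar>f' (u y)\<bar> * norm (g (y + l) - g y)"
          by (rule order_trans[OF norm_triangle_ineq]) simp
        also have "\<dots> \<le> e1 / (2 * (B1 + 1)) * (B1 + 1) + L * (B2 * norm l)"
        proof (intro add_mono mult_mono)
          have "dist (u (y + l)) (u y) < r" using ulip[of y l] l1 by (simp add: dist_norm)
          then show "\<bar>f' (u (y + l)) - f' (u y)\<bar> \<le> e1 / (2 * (B1 + 1))"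
            using r(2)[OF uI uI] by (fastforce simp: dist_real_def)
          show "norm (g (y + l)) \<le> B1 + 1" using B1[of "y + l"] by simp
        qed (use L[OF uI] glip e1 B10 L0 in auto)
        also have "e1 / (2 * (B1 + 1)) * (B1 + 1) = e1 / 2"
          using B10 by (simp add: field_simps)
        also have "e1 / 2 + L * (B2 * norm l) \<le> e1" using l3 by simp
        finally show ?thesis .
      qed
      define v where "v y = u (y + l) - u y" for y
      have v: "has_grad_hessian v (\<lambda>y. g (y + l) - g y) (\<lambda>y. H (y + l) - H y)"
        unfolding v_def by (rule has_grad_hessian_diff[OF has_grad_hessian_translate[OF u] u])
      have vlip: "norm (v (y + k) - v y) \<le> e1 * norm k" for y k
      proof (rule lipschitz_of_derivative_bound[OF has_grad_hessianD(1)[OF v]])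
        show "norm ((g (y + l) - g y) \<bullet> h) \<le> e1 * norm h" for y h
          using Cauchy_Schwarz_ineq2[of "g (y + l) - g y" h]
            mult_right_mono[OF order_trans[OF glip l2], of "norm h" y] by simp
      qed
      \<comment> \<open>Minus the Laplacian of \<open>v\<close>.\<close>
      define q where "q y = f (u (y + l)) - f (u y)" for y
      have dq: "(q has_derivative (\<lambda>h. (p (y + l) - p y) \<bullet> h)) (at y)" for y
        unfolding q_def inner_diff_left
        by (intro has_derivative_diff dfu has_derivative_compose[OF _ dfu, where f = "\<lambda>y. y + l"])
          (auto intro!: derivative_eq_intros)
      have qlip: "norm (q (y + k) - q y) \<le> e1 * norm k" for y k
      proof (rule lipschitz_of_derivative_bound[OF dq])
        show "norm ((p (y + l) - p y) \<bullet> h) \<le> e1 * norm h" for y h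
          using Cauchy_Schwarz_ineq2[of "p (y + l) - p y" h]
            mult_right_mono[OF pl, of "norm h" y] by simp
      qed
      define G where "G y = g (y + l) - g y" for y
      \<comment> \<open>Here the second increment enters: the gradient estimate is applied to
        \<open>v (y + k) - v y\<close>. The resulting Lipschitz constant \<open>e\<close> of
        \<open>G\<close> bounds its derivative \<open>H (x + l) - H x\<close>.\<close>
      have Glip: "norm (G (y + k) - G y) \<le> e * norm k" for y k
      proof -
        have "norm (G (y + k) - G y) \<le> C * (e1 * norm k + e1 * norm k)"
          unfolding C_def G_def
        proof (rule gradient_bound[OF has_grad_hessian_diff[OF has_grad_hessian_translate[OF v] v]])
          show "\<bar>v (y + k) - v y\<bar> \<le> e1 * norm k" for y using vlip[of y k] by simp
          show "\<bar>trace (H (y + k + l) - H (y + k) - (H (y + l) - H y))\<bar> \<le> e1 * norm k" for y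
            using qlip[of y k] by (simp add: trace_sub eq q_def)
        qed
        also have "\<dots> = e * norm k" using C0 by (simp add: e1_def)
        finally show ?thesis .
      qed
      have "(G has_derivative (\<lambda>h. (H (x + l) - H x) *v h)) (at x)"
        using has_grad_hessianD(2)[OF v] by (simp add: G_def[abs_def])
      then have "norm ((H (x + l) - H x) *v h) \<le> e * norm h"
        by (rule derivative_bound_of_lipschitz) (rule Glip)
      then show ?thesis by (simp add: matrix_vector_mult_diff_rdistrib)
    qed
    ultimately show ?thesis by blast
  qed
  show ?thesis
  proof (rule that[of "max B1 B2"])
    show "norm (g x) \<le> max B1 B2" for x using B1[of x] by simp
    show "norm (H x *v h) \<le> max B1 B2 * norm h" for x h
      using Hbd[of x h] by (rule order_trans) (intro mult_right_mono, auto)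
    show "norm (u (x + k) - u x) \<le> max B1 B2 * norm k" for x k
      using ulip[of x k] by (rule order_trans) (intro mult_right_mono, auto)
    show "norm (g (x + k) - g x) \<le> max B1 B2 * norm k" for x k
      using glip[of x k] by (rule order_trans) (intro mult_right_mono, auto)
  qed (fact Huc)
qed

section \<open>Passage between partial derivatives and gradient-Hessian data\<close>

lemma has_derivative_grad:
  fixes u :: "real^'n::finite \<Rightarrow> real"
  assumes "u differentiable (at x)"
  shows "(u has_derivative (\<lambda>h. grad u x \<bullet> h)) (at x)"
proof -
  let ?D = "frechet_derivative u (at x)"
  have D: "(u has_derivative ?D) (at x)"
    using assms frechet_derivative_works by blast
  then have lin: "linear ?D" by (simp add: has_derivative_linear)
  have "?D h = grad u x \<bullet> h" for h
  proof -
    have "?D h = ?D (\<Sum>i\<in>UNIV. h $ i *\<^sub>R axis i 1)"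
      using basis_expansion[of h] by (simp add: scalar_mult_eq_scaleR)
    also have "\<dots> = (\<Sum>i\<in>UNIV. h $ i * ?D (axis i 1))"
      by (simp add: linear_sum[OF lin] linear_cmul[OF lin])
    finally show ?thesis by (simp add: inner_vec_def grad_def pderivative_def mult.commute)
  qed
  then show ?thesis using D by presburger
qed

lemma pderivative_eq:
  assumes "(u has_derivative (\<lambda>h. p \<bullet> h)) (at x)"
  shows "pderivative i u x = p $ i"
  unfolding pderivative_def frechet_derivative_at[OF assms, symmetric] by (simp add: inner_axis)

lemma has_derivative_vecI:
  fixes g :: "'a::real_normed_vector \<Rightarrow> real^'n::finite"
  assumes "\<And>i. ((\<lambda>x. g x $ i) has_derivative (\<lambda>h. D h $ i)) (at x)"
  shows "(g has_derivative D) (at x)"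
  using assms unfolding has_derivative_componentwise_within[of g]
  by (auto simp: Basis_vec_def inner_axis)

text \<open>\<open>C_k 2\<close> includes total differentiability of every first partial derivative,
  so \<open>grad u\<close> is differentiable componentwise; row \<open>i\<close> of the matrix is
  the gradient of the i-th partial derivative.\<close>

lemma has_grad_hessian_of_C2:
  fixes u :: "real^'n::finite \<Rightarrow> real"
  assumes "C_k 2 u"
  shows "has_grad_hessian u (grad u) (\<lambda>x. \<chi> i j. pderivative j (pderivative i u) x)"
proof -
  have u: "u differentiable (at x)" and pu: "pderivative i u differentiable (at x)" for x i
    using assms by (auto simp: numeral_2_eq_2)
  have "(grad u has_derivative (\<lambda>h. (\<chi> i j. pderivative j (pderivative i u) x) *v h)) (at x)" for x
  proof (rule has_derivative_vecI)
    show "((\<lambda>x. grad u x $ i) has_derivative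
        (\<lambda>h. ((\<chi> i j. pderivative j (pderivative i u) x) *v h) $ i)) (at x)" for i
      using has_derivative_grad[OF pu, of i x]
      by (simp add: grad_def matrix_vector_mul_component)
  qed
  then show ?thesis
    using has_derivative_grad[OF u] by (simp add: has_grad_hessian_def)
qed

lemma laplacian_eq_trace: "laplacian u x = trace (\<chi> i j. pderivative j (pderivative i u) x)"
  by (simp add: laplacian_def trace_def)

lemma
  fixes u :: "real^'n::finite \<Rightarrow> real"
  assumes u: "has_grad_hessian u g H"
  shows C2_of_has_grad_hessian: "continuous_on UNIV H \<Longrightarrow> C_k 2 u"
    and laplacian_of_has_grad_hessian: "laplacian u x = trace (H x)"
proof -
  have p: "pderivative i u = (\<lambda>x. g x $ i)" for i
    using pderivative_eq[OF has_grad_hessianD(1)[OF u]] by blast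
  have dg: "((\<lambda>x. g x $ i) has_derivative (\<lambda>h. H x $ i \<bullet> h)) (at x)" for x i
    using has_derivative_compose[OF has_grad_hessianD(2)[OF u]
        bounded_linear_imp_has_derivative[OF bounded_linear_vec_nth]]
    by (simp add: matrix_vector_mul_component)
  have pp: "pderivative j (\<lambda>x. g x $ i) = (\<lambda>x. H x $ i $ j)" for i j
    using pderivative_eq[OF dg] by blast
  show "laplacian u x = trace (H x)"
    by (simp add: laplacian_def trace_def p pp)
  show "C_k 2 u" if "continuous_on UNIV H"
    using has_grad_hessianD(1)[OF u] dg that
    by (auto simp: numeral_2_eq_2 p pp differentiable_def intro!: continuous_intros)
qed

section \<open>Pointwise limits of translates\<close>

text \<open>An Arzela-Ascoli argument. Boundedness gives a subsequence converging on a countable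
  dense set; all translates share the modulus of continuity of \<open>J\<close>, which spreads the
  Cauchy property to every point and is inherited by the limit.\<close>

lemma translates_convergent_subsequence:
  fixes J :: "'a::euclidean_space \<Rightarrow> 'b::{real_normed_vector,heine_borel}"
  assumes bdd: "bounded (range J)" and uc: "uniformly_continuous_on UNIV J"
  obtains k V where "strict_mono (k :: nat \<Rightarrow> nat)" "\<And>x. (\<lambda>n. J (x + a (k n))) \<longlonglongrightarrow> V x"
    "uniformly_continuous_on UNIV V"
proof -
  obtain S :: "'a set" where S: "countable S" "\<And>X. open X \<Longrightarrow> X \<noteq> {} \<Longrightarrow> \<exists>d\<in>S. d \<in> X"
    using countable_dense_exists by metis
  obtain B where B: "\<And>x. norm (J x) \<le> B" using bdd by (auto simp: bounded_iff)
  obtain k where k: "strict_mono (k :: nat \<Rightarrow> nat)"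
    "\<And>x. x \<in> S \<Longrightarrow> \<exists>l. (\<lambda>n. J (x + a (k n))) \<longlonglongrightarrow> l"
    using function_convergent_subsequence[OF S(1), of "\<lambda>n x. J (x + a n)" B] B by blast
  have "Cauchy (\<lambda>n. J (x + a (k n)))" for x
  proof (rule metric_CauchyI)
    fix e :: real assume "0 < e"
    then obtain d where d: "d > 0" "\<And>y z. dist z y < d \<Longrightarrow> dist (J z) (J y) < e / 3"
      using uc[unfolded uniformly_continuous_on_def, rule_format, of "e / 3"] by auto
    obtain y where y: "y \<in> S" "dist x y < d"
      using S(2)[of "ball x d"] d(1) by auto
    have "Cauchy (\<lambda>n. J (y + a (k n)))"
      using k(2)[OF y(1)] by (auto intro: LIMSEQ_imp_Cauchy)
    then obtain N where N: "\<And>m n. m \<ge> N \<Longrightarrow> n \<ge> N \<Longrightarrow> dist (J (y + a (k m))) (J (y + a (k n))) < e / 3"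
      using metric_CauchyD[of _ "e / 3"] \<open>0 < e\<close> by force
    have "dist (J (x + a (k m))) (J (x + a (k n))) < e" if "m \<ge> N" "n \<ge> N" for m n
    proof -
      have "dist (J (x + a (k m))) (J (y + a (k m))) < e / 3" for m
        using y(2) by (intro d(2)) (simp add: dist_norm)
      from this[of m] this[of n] N[OF that] show ?thesis
        using dist_triangle[of "J (x + a (k m))" "J (x + a (k n))" "J (y + a (k m))"]
          dist_triangle[of "J (y + a (k m))" "J (x + a (k n))" "J (y + a (k n))"]
        by (simp add: dist_commute)
    qed
    then show "\<exists>N. \<forall>m\<ge>N. \<forall>n\<ge>N. dist (J (x + a (k m))) (J (x + a (k n))) < e" by blast
  qed
  then have "\<exists>l. (\<lambda>n. J (x + a (k n))) \<longlonglongrightarrow> l" for x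
    using Cauchy_convergent convergent_def by blast
  then obtain V where V: "\<And>x. (\<lambda>n. J (x + a (k n))) \<longlonglongrightarrow> V x"
    by metis
  moreover have "uniformly_continuous_on UNIV V"
    unfolding uniformly_continuous_on_def
  proof (intro allI impI)
    fix e :: real assume "0 < e"
    \<comment> \<open>Limits preserve only weak inequalities, so \<open>e / 2\<close> leaves room
      for the strict one.\<close>
    then obtain d where d: "d > 0" "\<And>y z. dist z y < d \<Longrightarrow> dist (J z) (J y) < e / 2"
      using uc[unfolded uniformly_continuous_on_def, rule_format, of "e / 2"] by auto
    have "dist (V z) (V y) < e" if "dist z y < d" for y z
    proof -
      have "dist (V z) (V y) \<le> e / 2"
      proof (rule tendsto_upperbound[OF tendsto_dist[OF V V]])
        show "\<forall>\<^sub>F n in sequentially. dist (J (z + a (k n))) (J (y + a (k n))) \<le> e / 2"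
          using that by (intro always_eventually allI less_imp_le d(2)) (simp add: dist_norm)
      qed simp
      then show ?thesis using \<open>0 < e\<close> by simp
    qed
    then show "\<exists>d>0. \<forall>x\<in>UNIV. \<forall>x'\<in>UNIV. dist x' x < d \<longrightarrow> dist (V x') (V x) < e"
      using d(1) by blast
  qed
  ultimately show ?thesis using that k(1) by blast
qed

text \<open>Equicontinuity of the derivatives makes the Taylor remainder \<open>o(\<bar>h\<bar>)\<close> uniformly over
  all translates, so that it passes to a merely pointwise limit.\<close>

lemma has_derivative_limit_of_translates:
  fixes G :: "'a::euclidean_space \<Rightarrow> 'b::real_normed_vector"
  assumes G: "\<And>x. (G has_derivative D x) (at x)"
    and uc: "\<And>e. 0 < e \<Longrightarrow> \<exists>d>0. \<forall>x l h. norm l < d \<longrightarrow> norm (D (x + l) h - D x h) \<le> e * norm h"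
    and V: "\<And>x. (\<lambda>n. G (x + a n)) \<longlonglongrightarrow> V x"
    and E: "\<And>h. (\<lambda>n. D (x + a n) h) \<longlonglongrightarrow> E h" and lin: "bounded_linear E"
  shows "(V has_derivative E) (at x)"
  unfolding has_derivative_at_alt
proof (intro conjI allI impI lin)
  fix e :: real assume "0 < e"
  then obtain d where d: "d > 0" "\<And>x l h. norm l < d \<Longrightarrow> norm (D (x + l) h - D x h) \<le> e * norm h"
    using uc by metis
  have "norm (V y - V x - E (y - x)) \<le> e * norm (y - x)" if y: "norm (y - x) < d" for y
  proof (rule tendsto_upperbound)
    show "(\<lambda>n. norm (G (y + a n) - G (x + a n) - D (x + a n) (y - x)))
        \<longlonglongrightarrow> norm (V y - V x - E (y - x))"
      by (intro tendsto_intros V E)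
    \<comment> \<open>Mean value inequality for \<open>G\<close> minus its linearization at
      \<open>x + b\<close>, on a ball where \<open>D\<close> varies by at most \<open>e\<close>. The
      radius \<open>d\<close> does not depend on \<open>b\<close>, hence not on
      \<open>n\<close>.\<close>
    have "norm (G (y + b) - G (x + b) - D (x + b) (y - x)) \<le> e * norm (y - x)" for b
    proof -
      have "norm (G (y + b) - G (x + b) - D (x + b) ((y + b) - (x + b))) \<le> norm ((y + b) - (x + b)) * e"
      proof (rule differentiable_bound_linearization[where S = "ball (x + b) d"])
        show "x + b + t *\<^sub>R (y + b - (x + b)) \<in> ball (x + b) d" if "t \<in> {0..1}" for t
        proof -
          have "t * norm (y - x) \<le> norm (y - x)" using that by (simp add: mult_left_le_one_le)
          then show ?thesis using y that by (simp add: dist_norm)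
        qed
        show "(G has_derivative D z) (at z within ball (x + b) d)" for z
          using G has_derivative_at_withinI by blast
        show "onorm (D z - D (x + b)) \<le> e" if "z \<in> ball (x + b) d" for z
          using d(2)[of "z - (x + b)" "x + b"] that
          by (intro onorm_le) (simp add: dist_norm norm_minus_commute)
        show "x + b \<in> ball (x + b) d" using d(1) by simp
      qed
      then show ?thesis by (simp add: mult.commute)
    qed
    then show "\<forall>\<^sub>F n in sequentially.
        norm (G (y + a n) - G (x + a n) - D (x + a n) (y - x)) \<le> e * norm (y - x)"
      by simp
  qed simp
  then show "\<exists>d>0. \<forall>y. norm (y - x) < d \<longrightarrow> norm (V y - V x - E (y - x)) \<le> e * norm (y - x)"
    using d(1) by blast
qed

section \<open>Stability of limits of translates to infinity\<close>

lemma pderivative_translate: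
  fixes \<phi> :: "real^'n::finite \<Rightarrow> real"
  assumes "\<And>x. \<phi> differentiable (at x)"
  shows "(\<lambda>x. \<phi> (x - a)) differentiable (at x)"
    and "pderivative i (\<lambda>x. \<phi> (x - a)) = (\<lambda>x. pderivative i \<phi> (x - a))"
proof -
  have D: "((\<lambda>x. \<phi> (x - a)) has_derivative (\<lambda>h. grad \<phi> (x - a) \<bullet> h)) (at x)" for x
  proof -
    have t: "((\<lambda>x. x - a) has_derivative (\<lambda>h. h)) (at x)"
      by (auto intro!: derivative_eq_intros)
    show ?thesis by (rule has_derivative_compose[OF t has_derivative_grad[OF assms]])
  qed
  then show "(\<lambda>x. \<phi> (x - a)) differentiable (at x)" by (auto simp: differentiable_def)
  show "pderivative i (\<lambda>x. \<phi> (x - a)) = (\<lambda>x. pderivative i \<phi> (x - a))"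
    using pderivative_eq[OF D] by (auto simp: grad_def)
qed

lemma C1c_translate:
  fixes \<phi> :: "real^'n::finite \<Rightarrow> real"
  assumes \<phi>: "\<phi> \<in> C1c UNIV" and sub: "\<And>y. y \<in> closure {x. \<phi> x \<noteq> 0} \<Longrightarrow> y + a \<in> \<Omega>"
  shows "(\<lambda>x. \<phi> (x - a)) \<in> C1c \<Omega>"
proof -
  have d: "\<phi> differentiable (at x)" and c: "continuous_on UNIV (pderivative i \<phi>)" for x i
    using \<phi> by (auto simp: C1c_def)
  have "{x. \<phi> (x - a) \<noteq> 0} = (+) a ` {x. \<phi> x \<noteq> 0}"
  proof (intro set_eqI iffI)
    fix x assume "x \<in> {x. \<phi> (x - a) \<noteq> 0}"
    then show "x \<in> (+) a ` {x. \<phi> x \<noteq> 0}" by (intro image_eqI[of _ _ "x - a"]) auto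
  qed auto
  then have cl: "closure {x. \<phi> (x - a) \<noteq> 0} = (+) a ` closure {x. \<phi> x \<noteq> 0}"
    by (simp add: closure_translation)
  have "compact (closure {x. \<phi> (x - a) \<noteq> 0})"
    unfolding cl using \<phi> by (intro compact_translation) (auto simp: C1c_def)
  moreover have "closure {x. \<phi> (x - a) \<noteq> 0} \<subseteq> \<Omega>"
    unfolding cl using sub by (auto simp: add.commute)
  moreover have "C_k 1 (\<lambda>x. \<phi> (x - a))"
    using pderivative_translate[OF d]
    by (auto intro!: continuous_on_compose2[OF c] continuous_intros)
  ultimately show ?thesis by (simp add: C1c_def)
qed

lemma lborel_integral_translate:
  fixes F :: "'a::euclidean_space \<Rightarrow> real"
  assumes "continuous_on UNIV F"
  shows "(\<integral>x. F (x + a) \<partial>lborel) = (\<integral>x. F x \<partial>lborel)"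
proof -
  have "(\<integral>x. F x \<partial>lborel) = (\<integral>x. F x \<partial>distr lborel borel ((+) a))"
    by (simp add: lborel_distr_plus)
  also have "\<dots> = (\<integral>x. F (a + x) \<partial>lborel)"
    by (rule integral_distr) (simp_all add: borel_measurable_continuous_onI assms)
  finally show ?thesis by (simp add: add.commute)
qed

text \<open>Testing \<open>u\<close> with \<open>\<phi> (x - b n)\<close> is the same as testing
  \<open>u (x + b n)\<close> with \<open>\<phi>\<close>, by translation invariance of the integrals.
  This is allowed once the shifted support has left \<open>K\<close>. The gradient side does not
  depend on \<open>n\<close>, and dominated convergence handles the other side.\<close>

lemma is_stable_limit_of_translates:
  fixes u :: "real^'n::finite \<Rightarrow> real"
  assumes u: "continuous_on UNIV u" "bounded (range u)" and f': "continuous_on UNIV (deriv f)"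
    and stab: "stable_outside_compact f u"
    and b: "filterlim b at_infinity sequentially"
    and v: "\<And>x. (\<lambda>n. u (x + b n)) \<longlonglongrightarrow> v x"
  shows "is_stable f v"
  unfolding is_stable_def stability_inequality_def
proof
  fix \<phi> :: "real^'n \<Rightarrow> real" assume \<phi>: "\<phi> \<in> C1c UNIV"
  define S where "S = closure {x. \<phi> x \<noteq> 0}"
  have d: "\<phi> differentiable (at x)" and c: "continuous_on UNIV (pderivative i \<phi>)" for x i
    using \<phi> by (auto simp: C1c_def)
  have S: "compact S" using \<phi> by (simp add: C1c_def S_def)
  have \<phi>0: "\<phi> x = 0" if "x \<notin> S" for x
    using that closure_subset[of "{x. \<phi> x \<noteq> 0}"] by (auto simp: S_def)
  have cont\<phi>: "continuous_on UNIV \<phi>"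
    using d by (simp add: differentiable_imp_continuous_on differentiable_on_def)
  have contgrad: "continuous_on UNIV (grad \<phi>)"
    unfolding grad_def by (intro continuous_intros c)
  have contf': "continuous_on UNIV (\<lambda>x. deriv f (u x))"
    by (rule continuous_on_compose2[OF f' u(1)]) auto
  obtain M where M: "\<And>x. \<bar>u x\<bar> \<le> M" using u(2) by (auto simp: bounded_iff)
  have "compact (deriv f ` {- M..M})"
    using f' by (intro compact_continuous_image) (auto intro: continuous_on_subset)
  then obtain L where L: "\<And>y. y \<in> {- M..M} \<Longrightarrow> \<bar>deriv f y\<bar> \<le> L"
    using compact_imp_bounded by (fastforce simp: bounded_iff)
  have L': "\<bar>deriv f (u x)\<bar> \<le> L" for x using M[of x] by (intro L) (auto simp: abs_le_iff)
  obtain K where K: "compact K" "\<And>\<psi>. \<psi> \<in> C1c (- K) \<Longrightarrow> stability_inequality f u \<psi>"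
    using stab by (auto simp: stable_outside_compact_def)
  obtain r where r: "\<And>y. y \<in> K \<Longrightarrow> norm y \<le> r"
    using compact_imp_bounded[OF K(1)] by (auto simp: bounded_iff)
  obtain s where s: "\<And>y. y \<in> S \<Longrightarrow> norm y \<le> s"
    using compact_imp_bounded[OF S] by (auto simp: bounded_iff)
  \<comment> \<open>\<open>r\<close> bounds the norms in \<open>K\<close> and \<open>s\<close> those
    in the support, so the shifted support lies outside the ball of radius \<open>r\<close>.\<close>
  have "\<forall>\<^sub>F n in sequentially. norm (b n) > r + s"
    using filterlim_at_infinity_imp_norm_at_top[OF b] by (simp add: filterlim_at_top_dense)
  then have ineq: "\<forall>\<^sub>F n in sequentially.
      (\<integral>x. deriv f (u (x + b n)) * (\<phi> x)\<^sup>2 \<partial>lborel) \<le> (\<integral>x. (norm (grad \<phi> x))\<^sup>2 \<partial>lborel)"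
  proof eventually_elim
    case (elim n)
    have "y + b n \<in> - K" if "y \<in> S" for y
      using elim s[OF that] r[of "y + b n"] norm_diff_ineq[of "b n" y] by (auto simp: add.commute)
    then have "stability_inequality f u (\<lambda>x. \<phi> (x - b n))"
      by (intro K(2) C1c_translate[OF \<phi>]) (auto simp: S_def)
    moreover have "(\<integral>x. deriv f (u x) * (\<phi> (x - b n))\<^sup>2 \<partial>lborel)
        = (\<integral>x. deriv f (u (x + b n)) * (\<phi> x)\<^sup>2 \<partial>lborel)"
      by (subst lborel_integral_translate[symmetric, of _ "b n"])
        (auto intro!: continuous_intros contf' continuous_on_compose2[OF cont\<phi>])
    moreover have "grad (\<lambda>x. \<phi> (x - b n)) x = grad \<phi> (x - b n)" for x
      by (simp add: grad_def pderivative_translate(2)[OF d])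
    moreover have "(\<integral>x. (norm (grad \<phi> (x - b n)))\<^sup>2 \<partial>lborel) = (\<integral>x. (norm (grad \<phi> x))\<^sup>2 \<partial>lborel)"
      by (subst lborel_integral_translate[symmetric, of _ "b n"])
        (auto intro!: continuous_intros continuous_on_compose2[OF contgrad])
    ultimately show ?case by (simp add: stability_inequality_def)
  qed
  have "(\<lambda>n. \<integral>x. deriv f (u (x + b n)) * (\<phi> x)\<^sup>2 \<partial>lborel) \<longlonglongrightarrow> (\<integral>x. deriv f (v x) * (\<phi> x)\<^sup>2 \<partial>lborel)"
  proof (rule integral_dominated_convergence[where w = "\<lambda>x. L * (\<phi> x)\<^sup>2"])
    have lim: "(\<lambda>n. deriv f (u (x + b n)) * (\<phi> x)\<^sup>2) \<longlonglongrightarrow> deriv f (v x) * (\<phi> x)\<^sup>2" for x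
      using f' by (intro tendsto_intros isCont_tendsto_compose[OF _ v])
        (simp add: continuous_on_eq_continuous_at)
    show meas: "(\<lambda>x. deriv f (u (x + b n)) * (\<phi> x)\<^sup>2) \<in> borel_measurable lborel" for n
    proof -
      have "continuous_on UNIV (\<lambda>x. deriv f (u (x + b n)) * (\<phi> x)\<^sup>2)"
        by (intro continuous_intros cont\<phi> continuous_on_compose2[OF contf']) auto
      then show ?thesis by (simp add: borel_measurable_continuous_onI)
    qed
    show "(\<lambda>x. deriv f (v x) * (\<phi> x)\<^sup>2) \<in> borel_measurable lborel"
      by (rule borel_measurable_LIMSEQ_real[OF lim meas])
    \<comment> \<open>The dominating function is integrable because \<open>\<phi>\<close> is
      continuous and vanishes off the compact set \<open>S\<close>, so the indicator changes
      nothing.\<close>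
    have "integrable lborel (\<lambda>x. indicator S x *\<^sub>R (\<phi> x)\<^sup>2)"
      by (intro borel_integrable_compact S continuous_intros continuous_on_subset[OF cont\<phi>]) auto
    moreover have "indicator S x *\<^sub>R (\<phi> x)\<^sup>2 = (\<phi> x)\<^sup>2" for x
      using \<phi>0[of x] by (cases "x \<in> S") auto
    ultimately have "integrable lborel (\<lambda>x. (\<phi> x)\<^sup>2)" by (simp only:)
    then show "integrable lborel (\<lambda>x. L * (\<phi> x)\<^sup>2)" by simp
    show "AE x in lborel. (\<lambda>n. deriv f (u (x + b n)) * (\<phi> x)\<^sup>2) \<longlonglongrightarrow> deriv f (v x) * (\<phi> x)\<^sup>2"
      using lim by simp
    show "AE x in lborel. norm (deriv f (u (x + b n)) * (\<phi> x)\<^sup>2) \<le> L * (\<phi> x)\<^sup>2" for n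
      using L' by (intro AE_I2) (simp add: abs_mult mult_right_mono)
  qed
  then show "(\<integral>x. deriv f (v x) * (\<phi> x)\<^sup>2 \<partial>lborel) \<le> (\<integral>x. (norm (grad \<phi> x))\<^sup>2 \<partial>lborel)"
    by (rule tendsto_upperbound[OF _ ineq]) simp
qed

section \<open>Compactness of translated solutions and the conclusion\<close>

lemma semilinear_solution_limit_of_translates:
  fixes f :: "real \<Rightarrow> real" and u :: "real^'n::finite \<Rightarrow> real"
  assumes f: "f C1_differentiable_on UNIV"
    and sol: "C2_solution f u" and bdd: "bounded (range u)"
  obtains k v where "strict_mono (k :: nat \<Rightarrow> nat)" "C2_solution f v" "bounded (range v)"
    "\<And>x. (\<lambda>n. u (x + a (k n))) \<longlonglongrightarrow> v x"
proof -
  obtain f' where f': "\<And>y. (f has_real_derivative f' y) (at y)" "continuous_on UNIV f'"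
    using f by (auto simp: C1_differentiable_on_def has_real_derivative_iff_has_vector_derivative)
  define g where "g = grad u"
  define H where "H x = (\<chi> i j. pderivative j (pderivative i u) x)" for x
  have u: "has_grad_hessian u g H"
    using has_grad_hessian_of_C2[of u] sol by (simp add: g_def H_def[abs_def] C2_solution_def)
  have eq: "trace (H x) = - f (u x)" for x
  proof -
    have "- laplacian u x = f (u x)" using sol by (simp add: C2_solution_def)
    then show ?thesis by (simp add: H_def flip: laplacian_eq_trace)
  qed
  obtain B where B: "\<And>x. norm (g x) \<le> B" "\<And>x h. norm (H x *v h) \<le> B * norm h"
    "\<And>x k. norm (u (x + k) - u x) \<le> B * norm k" "\<And>x k. norm (g (x + k) - g x) \<le> B * norm k"
    and Huc: "\<And>e. 0 < e \<Longrightarrow>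
      \<exists>d>0. \<forall>x l h. norm l < d \<longrightarrow> norm (H (x + l) *v h - H x *v h) \<le> e * norm h"
    by (rule semilinear_solution_regularity[OF u eq f' bdd]) blast
  have B0: "0 \<le> B" using B(1)[of 0] norm_ge_zero order_trans by blast
  define N where "N = (real CARD('n))\<^sup>2"
  have N: "0 < N" by (simp add: N_def)
  have normA: "norm A \<le> N * e" if "\<And>h. norm (A *v h) \<le> e * norm h" for A :: "real^'n^'n" and e
    unfolding N_def using that by (rule norm_matrix_le)
  \<comment> \<open>One map for all three functions, so that a single subsequence makes solution,
    gradient and Hessian converge together.\<close>
  define J where "J x = (u x, g x, H x)" for x
  have "bounded (range g)" "bounded (range H)"
    using B(1) normA[OF B(2)] by (auto simp: bounded_iff)
  then have Jbdd: "bounded (range J)"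
    by (intro bounded_subset[OF bounded_Times[OF bdd bounded_Times]]) (auto simp: J_def)
  have Juc: "uniformly_continuous_on UNIV J"
    unfolding uniformly_continuous_on_def
  proof (intro allI impI)
    fix e :: real assume "0 < e"
    \<comment> \<open>The factor \<open>N\<close> lost in passing to the Frobenius norm is divided
      out in advance; each of the three components of \<open>J\<close> then moves by at most
      \<open>e / 4\<close>.\<close>
    then obtain d where d: "d > 0"
      "\<And>x l h. norm l < d \<Longrightarrow> norm (H (x + l) *v h - H x *v h) \<le> e / (4 * N) * norm h"
      using Huc[of "e / (4 * N)"] N by auto
    define d' where "d' = min d (e / (4 * (B + 1)))"
    have "0 < d'" using d(1) \<open>0 < e\<close> B0 by (simp add: d'_def)
    moreover have "dist (J y) (J x) < e" if xy: "dist y x < d'" for x y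
    proof -
      define l where "l = y - x"
      have l: "norm l < d" "norm l < e / (4 * (B + 1))" and y: "y = x + l"
        using xy by (auto simp: l_def d'_def dist_norm)
      have "B * norm l \<le> (B + 1) * norm l" by (simp add: algebra_simps)
      also have "\<dots> \<le> e / 4" using l(2) B0 by (simp add: field_simps)
      finally have Bl: "B * norm l \<le> e / 4" .
      have "norm (H (x + l) - H x) \<le> N * (e / (4 * N))"
        by (rule normA) (use d(2)[OF l(1)] in \<open>simp add: matrix_vector_mult_diff_rdistrib\<close>)
      then have Hl: "norm (H (x + l) - H x) \<le> e / 4" using N by simp
      have "dist (J y) (J x) \<le> norm (u (x + l) - u x) + (norm (g (x + l) - g x) + norm (H (x + l) - H x))"
        unfolding dist_norm J_def y diff_Pair by (intro order_trans[OF norm_Pair_le] add_left_mono norm_Pair_le)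
      also have "\<dots> < e"
        using B(3)[of x l] B(4)[of x l] Bl Hl \<open>0 < e\<close> by linarith
      finally show ?thesis .
    qed
    ultimately show "\<exists>d>0. \<forall>x\<in>UNIV. \<forall>x'\<in>UNIV. dist x' x < d \<longrightarrow> dist (J x') (J x) < e"
      by blast
  qed
  obtain k W where k: "strict_mono (k :: nat \<Rightarrow> nat)"
    and W: "\<And>x. (\<lambda>n. J (x + a (k n))) \<longlonglongrightarrow> W x" and Wuc: "uniformly_continuous_on UNIV W"
    using translates_convergent_subsequence[OF Jbdd Juc] by metis
  define v p Q where "v = (\<lambda>x. fst (W x))" and "p = (\<lambda>x. fst (snd (W x)))" and "Q = (\<lambda>x. snd (snd (W x)))"
  have v: "(\<lambda>n. u (x + a (k n))) \<longlonglongrightarrow> v x" for x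
    using tendsto_fst[OF W[of x]] by (simp add: J_def v_def)
  have p: "(\<lambda>n. g (x + a (k n))) \<longlonglongrightarrow> p x" for x
    using tendsto_fst[OF tendsto_snd[OF W[of x]]] by (simp add: J_def p_def)
  have Q: "(\<lambda>n. H (x + a (k n))) \<longlonglongrightarrow> Q x" for x
    using tendsto_snd[OF tendsto_snd[OF W[of x]]] by (simp add: J_def Q_def)
  have hv: "has_grad_hessian v p Q"
    unfolding has_grad_hessian_def
  proof (intro allI conjI)
    fix x
    show "(v has_derivative (\<lambda>h. p x \<bullet> h)) (at x)"
    proof (rule has_derivative_limit_of_translates[OF has_grad_hessianD(1)[OF u] _ v])
      show "(\<lambda>n. g (x + a (k n)) \<bullet> h) \<longlonglongrightarrow> p x \<bullet> h" for h
        by (intro tendsto_intros p)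
      show "\<exists>d>0. \<forall>x l h. norm l < d \<longrightarrow> norm (g (x + l) \<bullet> h - g x \<bullet> h) \<le> e * norm h"
        if "0 < e" for e
      proof (intro exI[of _ "e / (B + 1)"] conjI allI impI)
        show "0 < e / (B + 1)" using that B0 by simp
        fix x l h :: "real^'n" assume l: "norm l < e / (B + 1)"
        have "norm (g (x + l) \<bullet> h - g x \<bullet> h) \<le> norm (g (x + l) - g x) * norm h"
          using Cauchy_Schwarz_ineq2[of "g (x + l) - g x" h] by (simp add: inner_diff_left)
        also have "\<dots> \<le> e * norm h"
        proof (rule mult_right_mono)
          have "norm (g (x + l) - g x) \<le> (B + 1) * norm l"
            using B(4)[of x l] by (simp add: algebra_simps add_increasing)
          also have "\<dots> \<le> e" using l B0 by (simp add: field_simps)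
          finally show "norm (g (x + l) - g x) \<le> e" .
        qed simp
        finally show "norm (g (x + l) \<bullet> h - g x \<bullet> h) \<le> e * norm h" .
      qed
    qed (rule bounded_linear_inner_right)
    show "(p has_derivative (\<lambda>h. Q x *v h)) (at x)"
    proof (rule has_derivative_limit_of_translates[OF has_grad_hessianD(2)[OF u] Huc p])
      show "(\<lambda>n. H (x + a (k n)) *v h) \<longlonglongrightarrow> Q x *v h" for h
        unfolding matrix_vector_mult_def by (intro tendsto_intros Q)
    qed simp_all
  qed
  \<comment> \<open>The uniform continuity inherited by \<open>W\<close> supplies the continuity of
    second derivatives that \<open>C_k 2\<close> demands.\<close>
  have "continuous_on UNIV Q"
    unfolding Q_def
    by (intro continuous_intros uniformly_continuous_imp_continuous[OF Wuc])
  \<comment> \<open>The traces of the translated Hessians converge to both sides: entrywise, and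
    through the equation and the continuity of \<open>f\<close>.\<close>
  moreover have "trace (Q x) = - f (v x)" for x
  proof (rule LIMSEQ_unique)
    show "(\<lambda>n. trace (H (x + a (k n)))) \<longlonglongrightarrow> trace (Q x)"
      unfolding trace_def by (intro tendsto_intros Q)
    show "(\<lambda>n. trace (H (x + a (k n)))) \<longlonglongrightarrow> - f (v x)"
      unfolding eq by (intro tendsto_intros isCont_tendsto_compose[OF _ v] DERIV_isCont[OF f'(1)])
  qed
  ultimately have "C2_solution f v"
    by (simp add: C2_solution_def C2_of_has_grad_hessian[OF hv] laplacian_of_has_grad_hessian[OF hv])
  moreover have "bounded (range v)"
  proof -
    obtain M where M: "\<And>x. norm (u x) \<le> M" using bdd by (auto simp: bounded_iff)
    have "norm (v x) \<le> M" for x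
      by (rule tendsto_upperbound[OF tendsto_norm[OF v[of x]]]) (use M in auto)
    then show ?thesis by (auto simp: bounded_iff)
  qed
  ultimately show ?thesis using that k v by blast
qed

theorem proposition1p14:
  fixes f :: "real \<Rightarrow> real" and u :: "real^'n::finite \<Rightarrow> real"
  assumes "f C1_differentiable_on UNIV"
    and "\<And>v :: real^'n \<Rightarrow> real.
           (C2_solution f v \<and> bounded (range v) \<and> is_stable f v) \<longleftrightarrow> v = (\<lambda>x. 0)"
    and "C2_solution f u"
    and "bounded (range u)"
    and "stable_outside_compact f u"
  shows "(u \<longlongrightarrow> 0) at_infinity"
proof (rule ccontr)
  assume "\<not> ?thesis"
  then obtain e where e: "e > 0" "\<And>r. \<exists>x. r \<le> norm x \<and> e \<le> \<bar>u x\<bar>"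
    unfolding tendsto_iff eventually_at_infinity by (auto simp: not_less)
  have "\<forall>n. \<exists>x. real n \<le> norm x \<and> e \<le> \<bar>u x\<bar>" using e(2) by blast
  then obtain a where "\<forall>n. real n \<le> norm (a n) \<and> e \<le> \<bar>u (a n)\<bar>"
    by (rule choice[THEN exE])
  then have a: "\<And>n. real n \<le> norm (a n)" "\<And>n. e \<le> \<bar>u (a n)\<bar>" by auto
  obtain k v where k: "strict_mono (k :: nat \<Rightarrow> nat)" and v: "C2_solution f v" "bounded (range v)"
    and lim: "\<And>x. (\<lambda>n. u (x + a (k n))) \<longlonglongrightarrow> v x"
    using semilinear_solution_limit_of_translates[OF assms(1,3,4)] by metis
  have "filterlim (\<lambda>n. norm (a n)) at_top sequentially"
    by (rule filterlim_at_top_mono[OF filterlim_real_sequentially]) (simp add: a(1))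
  then have ak: "filterlim (\<lambda>n. a (k n)) at_infinity sequentially"
    using filterlim_compose[OF _ filterlim_subseq[OF k]] filterlim_norm_at_top_imp_at_infinity by blast
  obtain f' where f': "\<And>y. (f has_real_derivative f' y) (at y)" "continuous_on UNIV f'"
    using assms(1) by (auto simp: C1_differentiable_on_def has_real_derivative_iff_has_vector_derivative)
  \<comment> \<open>Stability is stated with \<open>deriv f\<close>; identifying it with
    \<open>f'\<close> gives its continuity.\<close>
  have "deriv f = f'" using f'(1) DERIV_imp_deriv by blast
  moreover have "continuous_on UNIV u"
    using assms(3) by (auto simp: C2_solution_def numeral_2_eq_2 differentiable_on_def
        intro!: differentiable_imp_continuous_on)
  ultimately have "is_stable f v"
    using f'(2) assms(4,5) ak lim by (intro is_stable_limit_of_translates[of u f "\<lambda>n. a (k n)" v]) auto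
  \<comment> \<open>The limit is a bounded stable solution, so uniqueness makes it vanish; at the
    origin this contradicts the lower bound \<open>e\<close> along \<open>a\<close>.\<close>
  then have "v = (\<lambda>x. 0)" using v assms(2)[of v] by blast
  then have "(\<lambda>n. u (a (k n))) \<longlonglongrightarrow> 0" using lim[of 0] by simp
  then have "(\<lambda>n. \<bar>u (a (k n))\<bar>) \<longlonglongrightarrow> 0" by (simp add: tendsto_rabs_zero_iff)
  then have "e \<le> 0" by (rule tendsto_lowerbound) (simp_all add: a(2))
  with e(1) show False by simp
qed

end
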